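(* For every triple $a,b,c$ of integers with $2\leq a\leq b\leq c$, there exists a connected graph $G$ such that $spvc(G)=a$, $\chi(G)=b$ and $\Delta(G)=c$.
   Context: All graphs are simple, finite and undirected. $\chi(G)$ is the chromatic number and $\Delta(G)$ the maximum degree of $G$. In the following definitions, vertex-colorings are arbitrary (adjacent vertices may receive the same color). A path in a vertex-colored graph is a vertex-proper path if any two adjacent internal vertices of the path differ in color (the end-vertices are not internal). A $u$-$v$ geodesic is a $u$-$v$ path of length $d(u,v)$. A vertex-colored graph is strong proper vertex-connected if for any two distinct vertices $u,v$ there exists a vertex-proper $u$-$v$ geodesic. For a connected graph $G$, $spvc(G)$ is the smallest number of colors required to make $G$ strong proper vertex-connected. *)

theory Defs
  imports "Graph_Theory.Graph_Theory"
begin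

text \<open>
  A finite simple undirected graph is an instance of \<^locale>\<open>Digraph.graph\<close>: an edge \<open>uv\<close> is
  the pair of opposite arcs \<open>(u, v)\<close>, \<open>(v, u)\<close>. Hence the degree of a vertex is its
  out-degree.
\<close>

definition max_degree :: "('a, 'b) pre_digraph \<Rightarrow> nat" where
  "max_degree G = Max (out_degree G ` verts G)"

definition proper_coloring :: "('a, 'b) pre_digraph \<Rightarrow> ('a \<Rightarrow> nat) \<Rightarrow> bool" where
  "proper_coloring G col \<longleftrightarrow> (\<forall>u v. u \<rightarrow>\<^bsub>G\<^esub> v \<longrightarrow> col u \<noteq> col v)"

definition chromatic_number :: "('a, 'b) pre_digraph \<Rightarrow> nat" where
  "chromatic_number G =
    (LEAST k. \<exists>col. col ` verts G \<subseteq> {..<k} \<and> proper_coloring G col)"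

definition graph_dist :: "('a, 'b) pre_digraph \<Rightarrow> 'a \<Rightarrow> 'a \<Rightarrow> ereal" where
  "graph_dist G u v = wf_digraph.\<mu> G (\<lambda>_. 1) u v"

definition geodesic :: "('a, 'b) pre_digraph \<Rightarrow> 'a \<Rightarrow> 'b awalk \<Rightarrow> 'a \<Rightarrow> bool" where
  "geodesic G u p v \<longleftrightarrow>
    pre_digraph.apath G u p v \<and> ereal (real (length p)) = graph_dist G u v"

text \<open>
  \<open>awalk_verts u p\<close> lists the vertices of \<open>p\<close> from \<open>u\<close> on, so \<open>butlast (tl _)\<close> leaves
  exactly the internal ones (none if \<open>p\<close> has at most one arc).
\<close>

definition vertex_proper_path ::
    "('a, 'b) pre_digraph \<Rightarrow> ('a \<Rightarrow> nat) \<Rightarrow> 'a \<Rightarrow> 'b awalk \<Rightarrow> 'a \<Rightarrow> bool" where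
  "vertex_proper_path G col u p v \<longleftrightarrow>
    pre_digraph.apath G u p v \<and>
    distinct_adj (map col (butlast (tl (pre_digraph.awalk_verts G u p))))"

definition strong_proper_vertex_connected ::
    "('a, 'b) pre_digraph \<Rightarrow> ('a \<Rightarrow> nat) \<Rightarrow> bool" where
  "strong_proper_vertex_connected G col \<longleftrightarrow>
    (\<forall>u \<in> verts G. \<forall>v \<in> verts G. u \<noteq> v \<longrightarrow>
      (\<exists>p. geodesic G u p v \<and> vertex_proper_path G col u p v))"

definition spvc :: "('a, 'b) pre_digraph \<Rightarrow> nat" where
  "spvc G =
    (LEAST k. \<exists>col. col ` verts G \<subseteq> {..<k} \<and> strong_proper_vertex_connected G col)"

end

theory Submission
  imports Defs
begin

text \<open>
  Take a clique on \<open>b\<close> vertices, attach one pendant vertex to each of \<open>a\<close> clique vertices, and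
  \<open>c - b\<close> further pendant vertices to one of these. The geodesic between two pendant vertices with
  different attachment points is unique and has these two points as internal vertices, so
  the \<open>a\<close> attachment points need distinct colors; this is the only constraint, since every other
  geodesic has at most one internal vertex. The clique forces \<open>\<chi> = b\<close>, and the distinguished
  clique vertex has degree \<open>(b - 1) + 1 + (c - b) = c\<close>.
\<close>

text \<open>\<open>\<mu>\<close> is an infimum of costs over all walks, and with unit weights the
  cost is the length. Minimality is therefore asked among walks, not just among paths.\<close>

lemma (in wf_digraph) graph_dist_eqI:
  assumes "awalk u p v" and "\<And>q. awalk u q v \<Longrightarrow> length p \<le> length q"
  shows "graph_dist G u v = ereal (real (length p))"
proof -
  have cost: "awalk_cost (\<lambda>_. 1) q = real (length q)" for q
    by (induct q) auto
  show ?thesis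
    unfolding graph_dist_def \<mu>_def cost
    by (rule antisym) (use assms in \<open>auto intro: INF_lower2 INF_greatest\<close>)
qed

text \<open>
  The clique is \<open>{..<b}\<close>; the pendant vertex \<open>b + i\<close> is attached to \<open>i\<close> if \<open>i < a\<close>, and to \<open>0\<close>
  otherwise.
\<close>
locale pendant_clique =
  fixes a b c :: nat
  assumes two_le_a: "2 \<le> a" and a_le_b: "a \<le> b" and b_le_c: "b \<le> c"
begin

definition anchor :: "nat \<Rightarrow> nat" where
  "anchor x = (if x < b then x else if x < a + b then x - b else 0)"

definition adj :: "nat \<Rightarrow> nat \<Rightarrow> bool" where
  "adj u v \<longleftrightarrow> u < a + c \<and> v < a + c \<and> u \<noteq> v \<and>
    (u < b \<and> v < b \<or> anchor u = v \<or> anchor v = u)"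

text \<open>The order \<open>a + c\<close> is \<open>b + a + (c - b)\<close>: the clique, one
  pendant vertex at each attachment point, and the extra ones at \<open>0\<close>.\<close>

definition K :: "(nat, nat \<times> nat) pre_digraph" where
  "K = \<lparr>verts = {..<a + c}, arcs = {(u, v). adj u v}, tail = fst, head = snd\<rparr>"

lemma K_simps [simp]:
  "verts K = {..<a + c}" "e \<in> arcs K \<longleftrightarrow> adj (fst e) (snd e)" "tail K = fst" "head K = snd"
  by (auto simp: K_def)

lemma adj_sym: "adj u v \<Longrightarrow> adj v u"
  by (auto simp: adj_def)

lemma dominates_K: "u \<rightarrow>\<^bsub>K\<^esub> v \<longleftrightarrow> adj u v"
  by (force simp: arcs_ends_conv)

lemma graph_K: "Digraph.graph K"
proof -
  have "arcs K \<subseteq> {..<a + c} \<times> {..<a + c}"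
    by (auto simp: adj_def)
  then have "finite (arcs K)"
    by (rule finite_subset) simp
  moreover have "symmetric K"
    by (auto simp: symmetric_def sym_def dominates_K adj_sym)
  ultimately show ?thesis
    by unfold_locales (auto simp: adj_def arc_to_ends_def)
qed

sublocale K: Digraph.graph K
  by (rule graph_K)

text \<open>The route through both anchors. Filtering out loops lets one formula also cover ends in
  the clique and ends with a common anchor.\<close>

definition geo :: "nat \<Rightarrow> nat \<Rightarrow> (nat \<times> nat) list" where
  "geo u v = filter (\<lambda>(x, y). x \<noteq> y) [(u, anchor u), (anchor u, anchor v), (anchor v, v)]"

lemma anchor_less: "anchor x < b"
  using two_le_a a_le_b by (auto simp: anchor_def)

text \<open>Only pendant vertices are moved by \<open>anchor\<close>, and none of them hangs on a
  clique vertex from \<open>a\<close> on.\<close>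

lemma anchor_less_a: "anchor x \<noteq> x \<Longrightarrow> anchor x < a"
  using two_le_a by (auto simp: anchor_def split: if_splits)

lemma anchor_anchor [simp]: "anchor (anchor x) = anchor x"
  using anchor_less[of x] by (simp add: anchor_def)

lemma anchor_idem: "anchor x = y \<Longrightarrow> anchor y = y"
  by auto

lemma anchor_fixed: "x < b \<Longrightarrow> anchor x = x"
  by (simp add: anchor_def)

lemma adj_cases:
  "adj u v \<Longrightarrow> anchor u = u \<and> anchor v = v \<or> anchor u = v \<or> anchor v = u"
  by (auto simp: adj_def anchor_fixed)

lemma adj_anchor: "x < a + c \<Longrightarrow> x \<noteq> anchor x \<Longrightarrow> adj x (anchor x)"
  using anchor_less[of x] a_le_b b_le_c by (auto simp: adj_def)

lemma adj_anchors: "anchor x \<noteq> anchor y \<Longrightarrow> adj (anchor x) (anchor y)"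
  using anchor_less[of x] anchor_less[of y] a_le_b b_le_c by (auto simp: adj_def)

lemma geo_apath:
  assumes "u < a + c" "v < a + c" "u \<noteq> v"
  shows "K.apath u (geo u v) v"
  using assms adj_anchor[of u] adj_sym[OF adj_anchor[of v]] adj_anchors[of u v]
  by (auto simp: geo_def K.apath_def K.awalk_def dest: anchor_idem)

text \<open>Induction along the walk: moving the start across one edge shortens \<open>geo\<close>
  by at most one arc.\<close>

lemma geo_shortest:
  assumes "K.awalk u p v" "u \<noteq> v"
  shows "length (geo u v) \<le> length p"
proof -
  \<comment> \<open>The walk may visit \<open>v\<close> before its end, and \<open>geo v v\<close>
    has two arcs when \<open>v\<close> is pendant, so the value \<open>0\<close> at
    \<open>u = v\<close> is set by hand.\<close>
  have "(if u = v then 0 else length (geo u v)) \<le> length p"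
    using assms(1)
  proof (induction p arbitrary: u)
    case Nil
    then show ?case by (auto simp: K.awalk_Nil_iff)
  next
    case (Cons e p)
    then have e: "adj u (snd e)" and "K.awalk (snd e) p v"
      by (auto simp: K.awalk_Cons_iff)
    with Cons.IH have "(if snd e = v then 0 else length (geo (snd e) v)) \<le> length p"
      by blast
    moreover have "length (geo u v) \<le> Suc (if snd e = v then 0 else length (geo (snd e) v))"
      if "u \<noteq> v"
      using adj_cases[OF e] that by (auto simp: geo_def dest: anchor_idem)
    ultimately show ?case by (auto split: if_splits)
  qed
  with assms(2) show ?thesis by simp
qed

lemma graph_dist_K:
  assumes "u < a + c" "v < a + c" "u \<noteq> v"
  shows "graph_dist K u v = ereal (real (length (geo u v)))"
  using geo_apath[OF assms] geo_shortest assms(3)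
  by (intro K.graph_dist_eqI) (auto simp: K.apath_def)

lemma connected_K: "Digraph_Component.connected K"
proof -
  have "u \<rightarrow>\<^sup>*\<^bsub>K\<^esub> v" if "u < a + c" "v < a + c" for u v
    using geo_apath[OF that] that
    by (cases "u = v") (auto simp: K.apath_def intro: K.reachable_awalkI)
  moreover have "verts K \<noteq> {}"
    using two_le_a by (auto simp: lessThan_empty_iff)
  ultimately show ?thesis
    by (intro K.connectedI) (auto intro: K.reachable_mk_symmetricI)
qed

lemma anchors_colored_distinct:
  assumes "strong_proper_vertex_connected K col"
  shows "inj_on col {..<a}"
proof (rule inj_onI, rule ccontr)
  fix i j assume ij: "i \<in> {..<a}" "j \<in> {..<a}" "col i = col j" "i \<noteq> j"
  let ?u = "b + i" and ?v = "b + j"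
  have lt: "?u < a + c" "?v < a + c" "?u \<noteq> ?v"
    using ij b_le_c by auto
  have anc: "anchor ?u = i" "anchor ?v = j"
    using ij by (auto simp: anchor_def)
  obtain p where p: "geodesic K ?u p ?v" "vertex_proper_path K col ?u p ?v"
    using assms lt unfolding strong_proper_vertex_connected_def
    by (metis K_simps(1) lessThan_iff)
  have "length (geo ?u ?v) = 3"
    using ij a_le_b by (simp add: geo_def anc)
  then have "length p = 3"
    using p(1) graph_dist_K[OF lt] by (simp add: geodesic_def)
  then obtain e1 e2 e3 where pe: "p = [e1, e2, e3]"
    by (auto simp: numeral_3_eq_3 length_Suc_conv)
  have "K.awalk ?u p ?v"
    using p(1) by (simp add: geodesic_def K.apath_def)
  then have w: "adj ?u (fst e2)" "adj (snd e2) ?v"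
    "fst e3 = snd e2" "fst e2 = snd e1"
    unfolding pe by (auto simp: K.awalk_Cons_iff K.awalk_Nil_iff)
  \<comment> \<open>The only neighbor of a pendant vertex is its anchor. This determines the
    internal vertices of the given geodesic, which is not known to be \<open>geo\<close>.\<close>
  have pend: "x = anchor y" if "adj x y" "y \<ge> b" for x y
    using that anchor_less[of x] by (auto simp: adj_def)
  have "fst e2 = i" "snd e2 = j"
    using pend[OF adj_sym[OF w(1)]] pend[OF w(2)] anc by auto
  with p(2) ij w show False
    by (simp add: vertex_proper_path_def pe)
qed

lemma spvc_K: "spvc K = a"
  unfolding spvc_def
proof (rule Least_equality)
  \<comment> \<open>Reusing color \<open>0\<close> from \<open>a\<close> on is harmless:
    \<open>geo\<close> has two internal vertices only between pendant ends, and these are then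
    distinct anchors below \<open>a\<close>.\<close>
  let ?col = "\<lambda>x. if x < a then x else 0"
  have "strong_proper_vertex_connected K ?col"
    unfolding strong_proper_vertex_connected_def
  proof (intro ballI impI exI conjI)
    fix u v assume uv: "u \<in> verts K" "v \<in> verts K" "u \<noteq> v"
    then have ap: "K.apath u (geo u v) v"
      by (simp add: geo_apath)
    show "geodesic K u (geo u v) v"
      using uv ap by (simp add: geodesic_def graph_dist_K)
    show "vertex_proper_path K ?col u (geo u v) v"
      using ap anchor_less_a[of u] anchor_less_a[of v]
      by (auto simp: vertex_proper_path_def geo_def)
  qed
  moreover have "?col ` verts K \<subseteq> {..<a}"
    using two_le_a by auto
  ultimately show "\<exists>col. col ` verts K \<subseteq> {..<a} \<and> strong_proper_vertex_connected K col"
    by blast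
next
  fix k assume "\<exists>col. col ` verts K \<subseteq> {..<k} \<and> strong_proper_vertex_connected K col"
  then obtain col where col: "col ` verts K \<subseteq> {..<k}" "inj_on col {..<a}"
    using anchors_colored_distinct by blast
  then have "col ` {..<a} \<subseteq> {..<k}"
    by (simp add: image_subset_iff)
  from card_inj_on_le[OF col(2) this] show "a \<le> k"
    by simp
qed

lemma chromatic_number_K: "chromatic_number K = b"
  unfolding chromatic_number_def
proof (rule Least_equality)
  \<comment> \<open>A pendant vertex only has to avoid the color of its anchor;
    \<open>b \<ge> 2\<close> makes both \<open>0\<close> and \<open>1\<close> available.\<close>
  let ?col = "\<lambda>x. if x < b then x else if anchor x = 0 then 1 else 0"
  have "?col ` verts K \<subseteq> {..<b}"
    using two_le_a a_le_b by auto
  moreover have "?col u \<noteq> ?col v" if "adj u v" for u v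
    using that anchor_less[of u] anchor_less[of v] by (auto simp: adj_def anchor_fixed)
  then have "proper_coloring K ?col"
    by (simp add: proper_coloring_def dominates_K)
  ultimately show "\<exists>col. col ` verts K \<subseteq> {..<b} \<and> proper_coloring K col"
    by blast
next
  fix k assume "\<exists>col. col ` verts K \<subseteq> {..<k} \<and> proper_coloring K col"
  then obtain col where col: "col ` verts K \<subseteq> {..<k}" "proper_coloring K col"
    by blast
  have "inj_on col {..<b}"
  proof (rule inj_onI, rule ccontr)
    fix x y assume "x \<in> {..<b}" "y \<in> {..<b}" "col x = col y" "x \<noteq> y"
    then show False
      using col(2) b_le_c by (auto simp: proper_coloring_def dominates_K adj_def)
  qed
  moreover have "col ` {..<b} \<subseteq> {..<k}"
    using col(1) b_le_c by (simp add: image_subset_iff)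
  ultimately show "b \<le> k"
    using card_inj_on_le[of col "{..<b}" "{..<k}"] by simp
qed

lemma out_degree_K: "out_degree K u = card {v. adj u v}"
proof -
  have "out_arcs K u = Pair u ` {v. adj u v}"
    by (auto simp: out_arcs_def)
  then show ?thesis
    by (simp add: out_degree_def card_image inj_on_def)
qed

lemma max_degree_K: "max_degree K = c"
  unfolding max_degree_def
proof (rule Max_eqI)
  \<comment> \<open>In \<open>{1..b}\<close>, the last element \<open>b\<close> is the first pendant
    vertex at \<open>0\<close>, the others are the rest of the clique. The second interval holds the
    \<open>c - b\<close> extra pendant vertices.\<close>
  have "{v. adj 0 v} = {1..b} \<union> {a + b..<a + c}"
    using two_le_a a_le_b b_le_c by (auto simp: adj_def anchor_def split: if_splits)
  moreover have "{1..b} \<inter> {a + b..<a + c} = {}"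
    using two_le_a by auto
  ultimately have "out_degree K 0 = c"
    using b_le_c by (simp add: out_degree_K card_Un_disjoint)
  then show "c \<in> out_degree K ` verts K"
    using two_le_a by (intro image_eqI[of _ _ 0]) auto
  fix d assume "d \<in> out_degree K ` verts K"
  then obtain u where u: "u < a + c" "d = card {v. adj u v}"
    by (auto simp: out_degree_K)
  consider "u = 0" | "u \<noteq> 0" "u < b" | "u \<ge> b"
    by linarith
  then show "d \<le> c"
  proof cases
    case 1
    with u \<open>out_degree K 0 = c\<close> show ?thesis by (simp add: out_degree_K)
  next
    case 2
    \<comment> \<open>Any other clique vertex carries at most one pendant vertex,
      \<open>b + u\<close>, so its degree is at most \<open>b\<close>.\<close>
    then have "{v. adj u v} \<subseteq> insert (b + u) ({..<b} - {u})"
      by (auto simp: adj_def anchor_def split: if_splits)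
    then have "d \<le> card (insert (b + u) ({..<b} - {u}))"
      unfolding u(2) by (intro card_mono) auto
    with 2 b_le_c show ?thesis by (simp add: card_Diff_singleton)
  next
    case 3
    then have "{v. adj u v} \<subseteq> {anchor u}"
      using anchor_less by (auto simp: adj_def dest: leD)
    then have "d \<le> card {anchor u}"
      unfolding u(2) by (intro card_mono) auto
    with two_le_a a_le_b b_le_c show ?thesis by simp
  qed
qed simp

end

theorem theorem9:
  fixes a b c :: nat
  assumes "2 \<le> a" and "a \<le> b" and "b \<le> c"
  shows "\<exists>G :: (nat, nat \<times> nat) pre_digraph.
    Digraph.graph G \<and> Digraph_Component.connected G \<and>
    spvc G = a \<and> chromatic_number G = b \<and> max_degree G = c"
proof -
  interpret pendant_clique a b c
    using assms by unfold_locales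
  show ?thesis
    using graph_K connected_K spvc_K chromatic_number_K max_degree_K by blast
qed

end
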